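(* Let $\mathbb{k}$ be a field of characteristic $0$, let $l\ge 0$ and $r\ge 1$ be integers, and let $\mu=\sum_{j=1}^r\Lambda_j(\partial)\delta_{\xi_j}$ be an $r$-mixture of $l$-th order local mixtures of Diracs, i.e. $\xi_1,\dots,\xi_r\in\mathbb{k}$ are pairwise distinct and $\Lambda_j=\sum_{k=0}^{l}\lambda_{jk}\partial^k\in\mathbb{k}[\partial]$ with $\deg(\Lambda_j)=l$ for $1\le j\le r$. Then the parameters $\Lambda_j,\xi_j$ of $\mu$ can be recovered (up to simultaneous permutation of the index $j$) from the moments $m_0,m_1,\dots,m_{2(l+1)r-1}$ of $\mu$ using the parameter recovery algorithm described in the context; that is, applied to $l$, $r$ and these moments, the algorithm terminates and returns the points $\xi_j$ and the weights $\lambda_{jk}$.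
   Context: The moments of $\mu$ are $$m_i=\sum_{j=1}^r(\Lambda_j(\partial)(X^i))(\xi_j)=\sum_{j=1}^r\sum_{k=0}^{\min\{l,i\}}\lambda_{jk}\frac{i!}{(i-k)!}\xi_j^{i-k},\qquad i\in\mathbb{N},$$ where $\partial$ acts on $\mathbb{k}[X]$ as the derivative $d/dX$. For $a,b\in\mathbb{N}$ let $\mathrm{M}_{a,b}=(m_{i+j})_{0\le i\le a,\,0\le j\le b}$, an $(a+1)\times(b+1)$ Hankel matrix, which acts on polynomials in $\mathbb{k}[X]$ of degree at most $b$ via their coefficient vectors in the basis $1,X,\dots,X^b$. Parameter recovery algorithm (input: $l$, $r$, moments $m_0,m_1,\dots$): 1. Solve the polynomial system $\mathrm{M}_{r-1,(l+1)r}\,p^{l+1}=0$ for a monic polynomial $p=X^r+\sum_{i=0}^{r-1}p_iX^i$; here the unknowns are $p_0,\dots,p_{r-1}$, and $p^{l+1}$ denotes the coefficient vector of the $(l+1)$-th power of $p$. 2. If the solution set is infinite, increase the number of rows of the moment matrix (i.e. replace $\mathrm{M}_{r-1,(l+1)r}$ by $\mathrm{M}_{a,(l+1)r}$ with larger $a$) and repeat. 3. If there is more than one solution, use further information, such as additional moments (giving additional rows of the moment matrix), to restrict to a single solution $p$. 4. Compute the roots $\xi_1,\dots,\xi_r$ of $p$. 5. Compute the weights $\lambda_{jk}$ by solving the linear (confluent Vandermonde) system $\sum_{j=1}^r\sum_{k=0}^{\min\{l,i\}}\lambda_{jk}\frac{i!}{(i-k)!}\xi_j^{i-k}=m_i$,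 with one equation for each given moment $m_i$, in the unknowns $\lambda_{jk}$ ($1\le j\le r$, $0\le k\le l$) for the computed $\xi_j$. *)

theory Defs
  imports "HOL-Computational_Algebra.Polynomial" "Jordan_Normal_Form.Matrix"
    "HOL-Combinatorics.Permutations"
begin

text \<open>The action of \<open>\<Lambda>(\<partial>)\<close> on polynomials, where \<open>\<partial>\<close> acts as \<open>d/dX\<close>.\<close>

definition diff_op :: "'a::field_char_0 poly \<Rightarrow> 'a poly \<Rightarrow> 'a poly" where
  "diff_op \<Lambda> f = (\<Sum>k\<le>degree \<Lambda>. Polynomial.smult (coeff \<Lambda> k) ((pderiv ^^ k) f))"

text \<open>The mixture \<open>\<Sum>j. \<Lambda>\<^sub>j(\<partial>) \<delta>\<^bsub>\<xi>\<^sub>j\<^esub>\<close> as a linear functional on polynomials. The sign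
  convention is \<open>(\<partial>\<delta>\<^sub>\<xi>)(f) = f'(\<xi>)\<close>, without the factor \<open>-1\<close> of distribution theory.
  Components are indexed by \<open>j < r\<close>.\<close>

definition mixture :: "nat \<Rightarrow> (nat \<Rightarrow> 'a::field_char_0 poly) \<Rightarrow> (nat \<Rightarrow> 'a) \<Rightarrow> 'a poly \<Rightarrow> 'a" where
  "mixture r \<Lambda> \<xi> f = (\<Sum>j<r. poly (diff_op (\<Lambda> j) f) (\<xi> j))"

definition moment :: "('a::field_char_0 poly \<Rightarrow> 'a) \<Rightarrow> nat \<Rightarrow> 'a" where
  "moment \<mu> i = \<mu> (monom 1 i)"

text \<open>Meaningful only if \<open>a + b < length ms\<close>.\<close>

definition hankel :: "'a list \<Rightarrow> nat \<Rightarrow> nat \<Rightarrow> 'a mat" where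
  "hankel ms a b = mat (a + 1) (b + 1) (\<lambda>(i, j). ms ! (i + j))"

definition coeff_vec :: "nat \<Rightarrow> 'a::zero poly \<Rightarrow> 'a vec" where
  "coeff_vec b q = vec (b + 1) (coeff q)"

definition solutions :: "nat \<Rightarrow> nat \<Rightarrow> 'a::field_char_0 list \<Rightarrow> nat \<Rightarrow> 'a poly set" where
  "solutions l r ms a = {p. degree p = r \<and> lead_coeff p = 1 \<and>
     hankel ms a ((l + 1) * r) *\<^sub>v coeff_vec ((l + 1) * r) (p ^ (l + 1)) = 0\<^sub>v (a + 1)}"

text \<open>The confluent Vandermonde system for the weights, one equation per given moment.\<close>

definition solves_weights ::
  "nat \<Rightarrow> nat \<Rightarrow> 'a::field_char_0 list \<Rightarrow> 'a vec \<Rightarrow> 'a mat \<Rightarrow> bool" where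
  "solves_weights l r ms x w \<longleftrightarrow> w \<in> carrier_mat r (l + 1) \<and>
     (\<forall>i<length ms. (\<Sum>j<r. \<Sum>k\<le>min l i.
        w $$ (j, k) * (fact i / fact (i - k)) * (x $ j) ^ (i - k)) = ms ! i)"

text \<open>The parameter recovery algorithm as a transition system on the inputs \<open>l\<close>, \<open>r\<close> and the finite
  list \<open>ms\<close> of known moments. It is nondeterministic in how many rows are added, in the order of the
  roots, and in the choice of a solution of the linear system. \<open>Solve a\<close> means that the system with
  rows \<open>0, \<dots>, a\<close> is to be considered. The only further information available for singling out a
  solution is the remaining part of \<open>ms\<close>, so rows can be added only as long as all their entries
  occur in \<open>ms\<close>; a run that needs more than that gets stuck.\<close>

context notes [[typedef_overloaded]]
begin

datatype (dead 'a :: zero) recovery_state =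
    Solve nat
  | Found "'a poly"
  | Roots "'a vec"
  | Output "'a vec" "'a mat"

end

inductive recovery_step ::
  "nat \<Rightarrow> nat \<Rightarrow> 'a::field_char_0 list \<Rightarrow> 'a recovery_state \<Rightarrow> 'a recovery_state \<Rightarrow> bool"
  for l r ms where
  infinitely_many: "\<lbrakk>infinite (solutions l r ms a); a < a'; a' + (l + 1) * r < length ms\<rbrakk>
     \<Longrightarrow> recovery_step l r ms (Solve a) (Solve a')"
| finitely_many: "\<lbrakk>finite (solutions l r ms a); card (solutions l r ms a) > 1;
     a < a'; a' + (l + 1) * r < length ms\<rbrakk>
     \<Longrightarrow> recovery_step l r ms (Solve a) (Solve a')"
| unique: "solutions l r ms a = {p} \<Longrightarrow> recovery_step l r ms (Solve a) (Found p)"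
| roots: "\<lbrakk>x \<in> carrier_vec r; mset (list_of_vec x) = proots p\<rbrakk>
     \<Longrightarrow> recovery_step l r ms (Found p) (Roots x)"
| weights: "solves_weights l r ms x w \<Longrightarrow> recovery_step l r ms (Roots x) (Output x w)"

definition reachable :: "nat \<Rightarrow> nat \<Rightarrow> 'a::field_char_0 list \<Rightarrow> 'a recovery_state \<Rightarrow> bool" where
  "reachable l r ms s \<longleftrightarrow> (recovery_step l r ms)\<^sup>*\<^sup>* (Solve (r - 1)) s"

definition terminates :: "nat \<Rightarrow> nat \<Rightarrow> 'a::field_char_0 list \<Rightarrow> bool" where
  "terminates l r ms \<longleftrightarrow> \<not> (\<exists>s :: nat \<Rightarrow> 'a recovery_state.
     s 0 = Solve (r - 1) \<and> (\<forall>n. recovery_step l r ms (s n) (s (Suc n))))"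

definition never_stuck :: "nat \<Rightarrow> nat \<Rightarrow> 'a::field_char_0 list \<Rightarrow> bool" where
  "never_stuck l r ms \<longleftrightarrow> (\<forall>s. reachable l r ms s \<longrightarrow>
     (\<exists>x w. s = Output x w) \<or> (\<exists>s'. recovery_step l r ms s s'))"

end

theory Submission
  imports Defs
begin

text \<open>Write \<open>N = (l + 1) r\<close>. The functional \<open>\<mu>\<close> annihilates every multiple of
\<open>P = \<Prod>j. (X - \<xi>\<^sub>j)\<^bsup>l + 1\<^esup>\<close>, because \<open>\<Lambda>\<^sub>j(\<partial>)\<close> has order \<open>l\<close> and so cannot detect a zero of
order \<open>l + 1\<close>. The Hankel system with rows \<open>0, \<dots>, a\<close> says that \<open>\<mu>(X\<^sup>i p\<^bsup>l + 1\<^esup>) = 0\<close> for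
\<open>i \<le> a\<close>, so \<open>p = \<Prod>j. (X - \<xi>\<^sub>j)\<close> solves it for every \<open>a\<close>
for which the entries are known.

The converse direction and the uniqueness of the weights both rest on one family of test
polynomials, \<open>(X - \<xi>\<^sub>j)\<^sup>d \<Prod>i\<noteq>j. (X - \<xi>\<^sub>i)\<^bsup>l + 1\<^esup>\<close> with \<open>d \<le> l\<close>, of degree less than \<open>N\<close>. The
high-order zeros silence all components except the one at \<open>\<xi>\<^sub>j\<close>, and if \<open>d\<close> is the degree of
\<open>\<Lambda>\<^sub>j\<close>, the zero of order \<open>d\<close> leaves only the leading term of \<open>\<Lambda>\<^sub>j\<close>. Hence \<open>\<mu>\<close> of the test
polynomial times \<open>g\<close> is a nonzero multiple of \<open>g(\<xi>\<^sub>j)\<close> (lemma \<open>mixture_probe_mult_eq_0_iff\<close>).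

\<^item> With \<open>d = l\<close> and \<open>g = p\<^bsup>l + 1\<^esup>\<close>, a solution \<open>p\<close> of the system with all rows up to \<open>N - 1\<close>
  vanishes at every \<open>\<xi>\<^sub>j\<close>; being monic of degree \<open>r\<close>, it is \<open>\<Prod>j. (X - \<xi>\<^sub>j)\<close>
  (lemma \<open>solutions_full_eq\<close>). The moments occurring in this system are exactly
  \<open>m\<^sub>0, \<dots>, m\<^bsub>2N - 1\<^esub>\<close>.
\<^item> With \<open>g = 1\<close>, applied to the difference of two choices of weights at the same points, it shows
  that \<open>N\<close> moments determine the weights (lemma \<open>weights_unique\<close>).

The algorithm therefore carries the correct polynomial along as a solution at every stage, and as
long as the solution is not unique, it can still move on to row \<open>N - 1\<close>, where it is unique. Each
step either raises the row index, which is bounded by the number of moments, or passes to the next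
phase, so every run is finite.\<close>

section \<open>Differential operators applied to polynomials\<close>

text \<open>The Taylor expansion of \<open>(X - a)\<^sup>n h\<close> at \<open>a\<close> starts with \<open>h(a) (X - a)\<^sup>n\<close>. In particular, an
operator of order \<open>n\<close> sees a zero of order \<open>n\<close> only through its leading term.\<close>

lemma poly_higher_pderiv_linear_power_mult:
  fixes a :: "'a::field_char_0"
  assumes "k \<le> n"
  shows "poly ((pderiv ^^ k) ([:-a, 1:] ^ n * h)) a = (if k = n then fact n * poly h a else 0)"
  using assms
proof (induction k arbitrary: n h)
  case 0
  then show ?case by (cases n) simp_all
next
  case (Suc k)
  then obtain m where n: "n = Suc m" and "k \<le> m"
    by (cases n) auto
  define h' where "h' = Polynomial.smult (of_nat n) h + [:-a, 1:] * pderiv h"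
  have "pderiv ([:-a, 1:] ^ n * h) = [:-a, 1:] ^ m * h'"
    unfolding n h'_def pderiv_mult pderiv_power_Suc
    by (simp add: pderiv_pCons algebra_simps)
  then have "(pderiv ^^ Suc k) ([:-a, 1:] ^ n * h) = (pderiv ^^ k) ([:-a, 1:] ^ m * h')"
    by (simp only: funpow_Suc_right comp_apply)
  moreover have "poly h' a = of_nat n * poly h a"
    by (simp add: h'_def)
  ultimately show ?case
    using Suc.IH[OF \<open>k \<le> m\<close>, of h'] n by (simp add: algebra_simps)
qed

text \<open>A common upper summation bound makes operators of different degrees comparable, so that
\<open>diff_op\<close> becomes linear in the operator.\<close>

lemma diff_op_eq:
  assumes "degree \<Lambda> \<le> n"
  shows "diff_op \<Lambda> f = (\<Sum>k\<le>n. Polynomial.smult (coeff \<Lambda> k) ((pderiv ^^ k) f))"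
  unfolding diff_op_def
  by (rule sum.mono_neutral_left) (use assms in \<open>auto simp: coeff_eq_0\<close>)

lemma smult_sum_right:
  "Polynomial.smult c (\<Sum>i\<in>A. f i) = (\<Sum>i\<in>A. Polynomial.smult c (f i))"
  by (rule poly_eqI) (simp add: coeff_sum sum_distrib_left)

lemma diff_op_sum: "diff_op \<Lambda> (\<Sum>i\<in>A. f i) = (\<Sum>i\<in>A. diff_op \<Lambda> (f i))"
  unfolding diff_op_def higher_pderiv_sum smult_sum_right by (rule sum.swap)

lemma diff_op_smult: "diff_op \<Lambda> (Polynomial.smult c f) = Polynomial.smult c (diff_op \<Lambda> f)"
  by (simp add: diff_op_def higher_pderiv_smult smult_sum_right mult.commute)

lemma diff_op_diff: "diff_op (\<Lambda> - \<Gamma>) f = diff_op \<Lambda> f - diff_op \<Gamma> f"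
proof -
  define n where "n = max (degree \<Lambda>) (degree \<Gamma>)"
  have "degree \<Lambda> \<le> n" "degree \<Gamma> \<le> n" "degree (\<Lambda> - \<Gamma>) \<le> n"
    by (auto simp: n_def degree_diff_le_max)
  then show ?thesis
    by (simp add: diff_op_eq[of _ n] smult_diff_left sum_subtractf)
qed

section \<open>Mixtures as linear functionals\<close>

lemma mixture_sum: "mixture r \<Lambda> \<xi> (\<Sum>i\<in>A. f i) = (\<Sum>i\<in>A. mixture r \<Lambda> \<xi> (f i))"
  unfolding mixture_def diff_op_sum poly_sum by (rule sum.swap)

lemma mixture_smult: "mixture r \<Lambda> \<xi> (Polynomial.smult c f) = c * mixture r \<Lambda> \<xi> f"
  by (simp add: mixture_def diff_op_smult sum_distrib_left)

lemma mixture_diff: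
  "mixture r (\<lambda>j. \<Lambda> j - \<Gamma> j) \<xi> f = mixture r \<Lambda> \<xi> f - mixture r \<Gamma> \<xi> f"
  by (simp add: mixture_def diff_op_diff sum_subtractf)

lemma mixture_permute:
  assumes "\<pi> permutes {..<r}"
  shows "mixture r (\<lambda>j. \<Lambda> (\<pi> j)) (\<lambda>j. \<xi> (\<pi> j)) f = mixture r \<Lambda> \<xi> f"
  unfolding mixture_def
  using sum.permute[OF assms, of "\<lambda>j. poly (diff_op (\<Lambda> j) f) (\<xi> j)"] by (simp add: comp_def)

text \<open>The right-hand side is row \<open>i\<close> of the Hankel matrix applied to the coefficient vector of \<open>q\<close>.\<close>

lemma mixture_mult_eq_moments:
  assumes "degree q \<le> n"
  shows "mixture r \<Lambda> \<xi> (monom 1 i * q) = (\<Sum>k\<le>n. moment (mixture r \<Lambda> \<xi>) (i + k) * coeff q k)"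
proof -
  have "monom 1 i * q = (\<Sum>k\<le>n. Polynomial.smult (coeff q k) (monom 1 (i + k)))"
    by (subst poly_as_sum_of_monoms'[OF assms, symmetric])
      (simp add: sum_distrib_left mult_monom smult_monom)
  then show ?thesis
    by (simp add: mixture_sum mixture_smult moment_def mult.commute)
qed

text \<open>Vanishing on \<open>1, X, \<dots>, X\<^sup>n\<close> multiplied by \<open>q\<close> passes to linear combinations. This allows rows of
the Hankel system to be replaced by any convenient test polynomial.\<close>

lemma mixture_mult_eq_0:
  assumes "\<And>i. i \<le> n \<Longrightarrow> mixture r \<Lambda> \<xi> (monom 1 i * q) = 0" and "degree f \<le> n"
  shows "mixture r \<Lambda> \<xi> (f * q) = 0"
proof -
  have "f * q = (\<Sum>i\<le>n. Polynomial.smult (coeff f i) (monom 1 i * q))"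
    by (subst poly_as_sum_of_monoms'[OF assms(2), symmetric])
      (simp add: sum_distrib_right smult_monom flip: mult_smult_left)
  then show ?thesis
    using assms(1) by (simp add: mixture_sum mixture_smult)
qed

lemma higher_pderiv_monom_1:
  "(pderiv ^^ k) (monom (1::'a::field_char_0) i) =
    (if k \<le> i then monom (fact i / fact (i - k)) (i - k) else 0)"
proof -
  have "pochhammer (of_nat (Suc (i - k))) k = (fact i / fact (i - k) :: 'a)" if "k \<le> i"
    using pochhammer_product'[of "1::'a" "i - k" k] that
    by (simp add: of_nat_diff field_simps flip: pochhammer_fact)
  then show ?thesis
    by (intro poly_eqI) (auto simp: coeff_higher_pderiv simp del: of_nat_Suc)
qed

text \<open>The right-hand side is the one of the confluent Vandermonde system. So the solutions of that system
are the weights of mixtures with prescribed moments.\<close>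

lemma moment_mixture:
  assumes "\<And>j. j < r \<Longrightarrow> degree (\<Lambda> j) \<le> l"
  shows "moment (mixture r \<Lambda> \<xi>) i =
    (\<Sum>j<r. \<Sum>k\<le>min l i. coeff (\<Lambda> j) k * (fact i / fact (i - k)) * \<xi> j ^ (i - k))"
proof -
  have "poly (diff_op (\<Lambda> j) (monom 1 i)) (\<xi> j) =
      (\<Sum>k\<le>min l i. coeff (\<Lambda> j) k * (fact i / fact (i - k)) * \<xi> j ^ (i - k))" if "j < r" for j
  proof -
    have "poly (diff_op (\<Lambda> j) (monom 1 i)) (\<xi> j) =
        (\<Sum>k\<le>l. coeff (\<Lambda> j) k * poly ((pderiv ^^ k) (monom 1 i)) (\<xi> j))"
      using assms[OF that] by (simp add: diff_op_eq poly_sum)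
    also have "\<dots> = (\<Sum>k\<le>min l i. coeff (\<Lambda> j) k * poly ((pderiv ^^ k) (monom 1 i)) (\<xi> j))"
      by (rule sum.mono_neutral_right) (auto simp: higher_pderiv_monom_1)
    also have "\<dots> = (\<Sum>k\<le>min l i. coeff (\<Lambda> j) k * (fact i / fact (i - k)) * \<xi> j ^ (i - k))"
      by (rule sum.cong) (auto simp: higher_pderiv_monom_1 poly_monom mult.assoc)
    finally show ?thesis .
  qed
  then show ?thesis
    by (simp add: moment_def mixture_def)
qed

lemma moment_mixture_ext:
  assumes "\<And>i. i \<le> n \<Longrightarrow> moment (mixture r \<Lambda> \<xi>) i = 0" and "degree f \<le> n"
  shows "mixture r \<Lambda> \<xi> f = 0"
  using mixture_mult_eq_0[of n r \<Lambda> \<xi> 1 f] assms by (simp add: moment_def)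

section \<open>The polynomial of the points\<close>

definition node_poly :: "nat \<Rightarrow> (nat \<Rightarrow> 'a::field_char_0) \<Rightarrow> 'a poly" where
  "node_poly r \<xi> = (\<Prod>j<r. [:- \<xi> j, 1:])"

lemma degree_node_poly: "degree (node_poly r \<xi>) = r"
  unfolding node_poly_def by (subst degree_prod_sum_eq) simp_all

lemma lead_coeff_node_poly: "lead_coeff (node_poly r \<xi>) = 1"
  by (simp add: node_poly_def lead_coeff_prod)

lemma node_poly_eqI:
  assumes "inj_on \<xi> {..<r}" "degree p = r" "lead_coeff p = 1" "\<And>j. j < r \<Longrightarrow> poly p (\<xi> j) = 0"
  shows "p = node_poly r \<xi>"
proof (rule poly_eqI_degree_lead_coeff[where n = r and A = "\<xi> ` {..<r}"])
  show "coeff p r = coeff (node_poly r \<xi>) r"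
    using assms(2,3) lead_coeff_node_poly[of r \<xi>] by (simp add: degree_node_poly)
  show "poly p z = poly (node_poly r \<xi>) z" if "z \<in> \<xi> ` {..<r}" for z
    using that assms(4) by (auto simp: node_poly_def poly_prod)
qed (use assms in \<open>simp_all add: card_image degree_node_poly\<close>)

lemma proots_node_poly: "proots (node_poly r \<xi>) = mset (map \<xi> [0..<r])"
proof -
  have "proots (node_poly r \<xi>) = (\<Sum>j<r. {#\<xi> j#})"
    unfolding node_poly_def by (subst proots_prod) simp_all
  also have "\<dots> = mset (map \<xi> [0..<r])"
    by (induction r) simp_all
  finally show ?thesis .
qed

section \<open>Isolating one component of a mixture\<close>

text \<open>The test polynomial for component \<open>j\<close>: it has zeros too high for an operator of order \<open>l\<close> to
detect at all other points, and a zero of adjustable order \<open>d\<close> at \<open>\<xi>\<^sub>j\<close>.\<close>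

definition probe :: "nat \<Rightarrow> (nat \<Rightarrow> 'a::field_char_0) \<Rightarrow> nat \<Rightarrow> nat \<Rightarrow> nat \<Rightarrow> 'a poly" where
  "probe r \<xi> l j d = [:- \<xi> j, 1:] ^ d * (\<Prod>i\<in>{..<r} - {j}. [:- \<xi> i, 1:] ^ (l + 1))"

text \<open>The bound leaves room for every \<open>d \<le> l\<close>, so the rows \<open>0, \<dots>, (l + 1) r - 1\<close> suffice for testing
with \<open>probe\<close>.\<close>

lemma degree_probe:
  assumes "j < r" "d \<le> l"
  shows "degree (probe r \<xi> l j d) < (l + 1) * r"
proof -
  have "degree (probe r \<xi> l j d) = d + (r - 1) * (l + 1)"
    unfolding probe_def using assms(1)
    by (subst degree_mult_eq)
      (auto simp: degree_prod_sum_eq degree_linear_power simp del: power_Suc)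
  also have "\<dots> < (l + 1) * r"
    using assms by (cases r) (auto simp: algebra_simps)
  finally show ?thesis .
qed

lemma poly_diff_op_vanish:
  assumes "degree \<Lambda> \<le> l" "[:- a, 1:] ^ (l + 1) dvd f"
  shows "poly (diff_op \<Lambda> f) a = 0"
proof -
  obtain h where f: "f = [:- a, 1:] ^ (l + 1) * h"
    using assms(2) by (elim dvdE)
  show ?thesis
    unfolding diff_op_eq[OF assms(1)] f poly_sum poly_smult
    by (rule sum.neutral) (auto simp: poly_higher_pderiv_linear_power_mult simp del: power_Suc)
qed

text \<open>The components at \<open>\<xi>\<^sub>i\<close> with \<open>i \<noteq> j\<close> vanish. At \<open>\<xi>\<^sub>j\<close> there is a zero of order at least the degree of
\<open>\<Lambda>\<^sub>j\<close>, so all terms of \<open>\<Lambda>\<^sub>j(\<partial>)\<close> but the leading one vanish too.\<close>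

lemma mixture_probe_mult:
  assumes "\<And>i. i < r \<Longrightarrow> degree (\<Lambda> i) \<le> l" and "j < r"
  shows "mixture r \<Lambda> \<xi> (probe r \<xi> l j (degree (\<Lambda> j)) * g) =
    lead_coeff (\<Lambda> j) * fact (degree (\<Lambda> j)) * (\<Prod>i\<in>{..<r} - {j}. (\<xi> j - \<xi> i) ^ (l + 1)) * poly g (\<xi> j)"
proof -
  define d where "d = degree (\<Lambda> j)"
  define P where "P = (\<Prod>i\<in>{..<r} - {j}. [:- \<xi> i, 1:] ^ (l + 1))"
  define f where "f = probe r \<xi> l j d * g"
  have f: "f = [:- \<xi> j, 1:] ^ d * (P * g)"
    by (simp add: f_def probe_def P_def mult.assoc)
  have "poly (diff_op (\<Lambda> i) f) (\<xi> i) = 0" if "i < r" "i \<noteq> j" for i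
  proof (rule poly_diff_op_vanish[OF assms(1)[OF that(1)]])
    have "[:- \<xi> i, 1:] ^ (l + 1) dvd P"
      unfolding P_def by (rule dvd_prodI) (use that in auto)
    then show "[:- \<xi> i, 1:] ^ (l + 1) dvd f"
      unfolding f by (intro dvd_mult dvd_mult2)
  qed
  then have "mixture r \<Lambda> \<xi> f = (\<Sum>i<r. if i = j then poly (diff_op (\<Lambda> j) f) (\<xi> j) else 0)"
    unfolding mixture_def by (intro sum.cong) auto
  also have "\<dots> = poly (diff_op (\<Lambda> j) f) (\<xi> j)"
    using assms(2) by simp
  also have "\<dots> = (\<Sum>k\<le>d. coeff (\<Lambda> j) k * (if k = d then fact d * poly (P * g) (\<xi> j) else 0))"
    unfolding diff_op_def d_def[symmetric] poly_sum poly_smult f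
    by (intro sum.cong refl) (simp add: poly_higher_pderiv_linear_power_mult)
  also have "\<dots> = coeff (\<Lambda> j) d * (fact d * poly (P * g) (\<xi> j))"
    by (simp add: if_distrib[of "\<lambda>x. _ * x"] cong: if_cong)
  also have "poly (P * g) (\<xi> j) = (\<Prod>i\<in>{..<r} - {j}. (\<xi> j - \<xi> i) ^ (l + 1)) * poly g (\<xi> j)"
    by (simp add: P_def poly_prod poly_power del: power_Suc)
  finally show ?thesis
    by (simp add: f_def d_def mult.assoc)
qed

text \<open>In characteristic 0 the factorial is nonzero, and the product of differences is nonzero since the
points are distinct; so \<open>\<mu>\<close> tests whether \<open>g\<close> vanishes at the single point \<open>\<xi>\<^sub>j\<close>.\<close>

lemma mixture_probe_mult_eq_0_iff:
  assumes "inj_on \<xi> {..<r}" and "\<And>i. i < r \<Longrightarrow> degree (\<Lambda> i) \<le> l" and "j < r" and "\<Lambda> j \<noteq> 0"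
  shows "mixture r \<Lambda> \<xi> (probe r \<xi> l j (degree (\<Lambda> j)) * g) = 0 \<longleftrightarrow> poly g (\<xi> j) = 0"
proof -
  have "(\<Prod>i\<in>{..<r} - {j}. (\<xi> j - \<xi> i) ^ (l + 1)) \<noteq> 0"
    using assms(1,3) by (auto simp: inj_on_eq_iff simp del: power_Suc)
  then show ?thesis
    using assms(4)
    by (subst mixture_probe_mult[where \<Lambda> = \<Lambda> and l = l])
      (simp_all only: assms(2,3) mult_eq_0_iff leading_coeff_0_iff fact_nonzero simp_thms)
qed

text \<open>This is the injectivity of the confluent Vandermonde matrix. A nonzero \<open>\<Lambda>\<^sub>j\<close> would be detected by
the \<open>probe\<close> of order equal to its own degree, which may be less than \<open>l\<close>.\<close>

lemma mixture_eq_0_imp_weights_eq_0: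
  assumes "inj_on \<xi> {..<r}" and "\<And>i. i < r \<Longrightarrow> degree (\<Lambda> i) \<le> l"
    and "\<And>i. i < (l + 1) * r \<Longrightarrow> moment (mixture r \<Lambda> \<xi>) i = 0" and "j < r"
  shows "\<Lambda> j = 0"
proof (rule ccontr)
  assume "\<Lambda> j \<noteq> 0"
  have "degree (probe r \<xi> l j (degree (\<Lambda> j))) < (l + 1) * r"
    using assms(2,4) by (intro degree_probe) auto
  then have "mixture r \<Lambda> \<xi> (probe r \<xi> l j (degree (\<Lambda> j)) * 1) = 0"
    using assms(3) by (subst mult_1_right, intro moment_mixture_ext[where n = "(l + 1) * r - 1"]) auto
  then have "poly 1 (\<xi> j) = 0"
    by (subst (asm) mixture_probe_mult_eq_0_iff) (use assms \<open>\<Lambda> j \<noteq> 0\<close> in simp_all)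
  then show False by simp
qed

section \<open>Solutions of the Hankel system\<close>

lemma mem_solutions_iff:
  assumes "a + (l + 1) * r < L" and "ms = map (moment (mixture r \<Lambda> \<xi>)) [0..<L]"
  shows "p \<in> solutions l r ms a \<longleftrightarrow> degree p = r \<and> lead_coeff p = 1 \<and>
    (\<forall>i\<le>a. mixture r \<Lambda> \<xi> (monom 1 i * p ^ (l + 1)) = 0)"
proof -
  define N where "N = (l + 1) * r"
  have "hankel ms a N *\<^sub>v coeff_vec N (p ^ (l + 1)) = 0\<^sub>v (a + 1) \<longleftrightarrow>
      (\<forall>i\<le>a. mixture r \<Lambda> \<xi> (monom 1 i * p ^ (l + 1)) = 0)" if "degree p = r"
  proof -
    have deg: "degree (p ^ (l + 1)) \<le> N"
      using degree_power_le[of p "l + 1"] that by (simp add: N_def mult.commute del: power_Suc)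
    have "(hankel ms a N *\<^sub>v coeff_vec N (p ^ (l + 1))) $ i =
        mixture r \<Lambda> \<xi> (monom 1 i * p ^ (l + 1))" if "i \<le> a" for i
    proof -
      have "(hankel ms a N *\<^sub>v coeff_vec N (p ^ (l + 1))) $ i =
          (\<Sum>k\<in>{0..<N + 1}. ms ! (i + k) * coeff (p ^ (l + 1)) k)"
        using that by (simp add: hankel_def coeff_vec_def scalar_prod_def del: power_Suc sum.op_ivl_Suc)
      also have "\<dots> = (\<Sum>k\<le>N. moment (mixture r \<Lambda> \<xi>) (i + k) * coeff (p ^ (l + 1)) k)"
        using that assms by (intro sum.cong) (auto simp: N_def simp del: power_Suc)
      finally show ?thesis
        by (simp only: mixture_mult_eq_moments[OF deg])
    qed
    then show ?thesis
      by (auto simp: vec_eq_iff hankel_def simp del: power_Suc)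
  qed
  then show ?thesis
    unfolding solutions_def N_def by blast
qed

lemma node_poly_mem_solutions:
  assumes "\<And>j. j < r \<Longrightarrow> degree (\<Lambda> j) \<le> l"
    and "a + (l + 1) * r < L" and "ms = map (moment (mixture r \<Lambda> \<xi>)) [0..<L]"
  shows "node_poly r \<xi> \<in> solutions l r ms a"
proof -
  have "mixture r \<Lambda> \<xi> (f * node_poly r \<xi> ^ (l + 1)) = 0" for f
    unfolding mixture_def
  proof (rule sum.neutral, rule ballI)
    fix j assume "j \<in> {..<r}"
    then have "[:- \<xi> j, 1:] dvd node_poly r \<xi>"
      unfolding node_poly_def by (intro dvd_prodI) auto
    then have "[:- \<xi> j, 1:] ^ (l + 1) dvd f * node_poly r \<xi> ^ (l + 1)"
      by (intro dvd_mult dvd_power_same)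
    then show "poly (diff_op (\<Lambda> j) (f * node_poly r \<xi> ^ (l + 1))) (\<xi> j) = 0"
      using assms(1) \<open>j \<in> {..<r}\<close> by (intro poly_diff_op_vanish) auto
  qed
  then show ?thesis
    unfolding mem_solutions_iff[OF assms(2,3)]
    by (simp add: degree_node_poly lead_coeff_node_poly del: power_Suc)
      (metis degree_node_poly lead_coeff_node_poly)
qed

text \<open>It is enough to show that a solution \<open>p\<close> vanishes at each \<open>\<xi>\<^sub>j\<close>. Since \<open>\<Lambda>\<^sub>j\<close> has degree exactly \<open>l\<close>,
the \<open>probe\<close> of order \<open>l\<close> yields the value of \<open>p\<^bsup>l + 1\<^esup>\<close> at \<open>\<xi>\<^sub>j\<close> up to a nonzero factor, and the result is
0 because the \<open>probe\<close> is a combination of \<open>1, \<dots>, X\<^sup>a\<close>.\<close>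

lemma solutions_full_eq:
  assumes "inj_on \<xi> {..<r}" and "\<And>j. j < r \<Longrightarrow> \<Lambda> j \<noteq> 0 \<and> degree (\<Lambda> j) = l"
    and "a + (l + 1) * r < L" and "ms = map (moment (mixture r \<Lambda> \<xi>)) [0..<L]"
    and "(l + 1) * r \<le> a + 1"
  shows "solutions l r ms a = {node_poly r \<xi>}"
proof (rule antisym)
  show "{node_poly r \<xi>} \<subseteq> solutions l r ms a"
    using node_poly_mem_solutions[OF _ assms(3,4)] assms(2) by simp
next
  show "solutions l r ms a \<subseteq> {node_poly r \<xi>}"
  proof
    fix p assume "p \<in> solutions l r ms a"
    then have p: "degree p = r" "lead_coeff p = 1"
      and ann: "\<And>i. i \<le> a \<Longrightarrow> mixture r \<Lambda> \<xi> (monom 1 i * p ^ (l + 1)) = 0"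
      by (auto simp: mem_solutions_iff[OF assms(3,4)] simp del: power_Suc)
    have "poly p (\<xi> j) = 0" if "j < r" for j
    proof -
      have "degree (probe r \<xi> l j l) \<le> a"
        using degree_probe[OF that order_refl[of l], of \<xi>] assms(5) by linarith
      then have "mixture r \<Lambda> \<xi> (probe r \<xi> l j l * p ^ (l + 1)) = 0"
        by (intro mixture_mult_eq_0[OF ann])
      then have "poly (p ^ (l + 1)) (\<xi> j) = 0"
        using mixture_probe_mult_eq_0_iff
          [OF assms(1), where \<Lambda> = \<Lambda> and l = l and j = j and g = "p ^ (l + 1)"] assms(2) that
        by (simp del: power_Suc)
      then show ?thesis
        by (simp only: poly_power power_eq_0_iff)
    qed
    then show "p \<in> {node_poly r \<xi>}"
      using node_poly_eqI[OF assms(1) p] by simp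
  qed
qed

section \<open>The confluent Vandermonde system\<close>

lemma solves_weights_iff:
  assumes "\<And>j. j < r \<Longrightarrow> degree (\<Gamma> j) \<le> l"
    and "\<And>j k. j < r \<Longrightarrow> k \<le> l \<Longrightarrow> w $$ (j, k) = coeff (\<Gamma> j) k"
    and "w \<in> carrier_mat r (l + 1)" and "ms = map m [0..<L]"
    and "\<And>j. j < r \<Longrightarrow> x $ j = \<eta> j"
  shows "solves_weights l r ms x w \<longleftrightarrow> (\<forall>i<L. moment (mixture r \<Gamma> \<eta>) i = m i)"
proof -
  have "(\<Sum>j<r. \<Sum>k\<le>min l i. w $$ (j, k) * (fact i / fact (i - k)) * (x $ j) ^ (i - k)) =
      moment (mixture r \<Gamma> \<eta>) i" for i
    using assms(2,5)
    by (subst moment_mixture[where \<Lambda> = \<Gamma> and l = l]) (auto simp: assms(1) intro!: sum.cong)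
  then show ?thesis
    using assms(3,4) by (simp add: solves_weights_def)
qed

lemma true_weights_solve:
  assumes "\<And>j. j < r \<Longrightarrow> degree (\<Lambda> j) \<le> l"
    and "ms = map (moment (mixture r \<Lambda> \<xi>)) [0..<L]"
    and "\<pi> permutes {..<r}" and "\<And>j. j < r \<Longrightarrow> x $ j = \<xi> (\<pi> j)"
  shows "solves_weights l r ms x (mat r (l + 1) (\<lambda>(j, k). coeff (\<Lambda> (\<pi> j)) k))"
proof -
  have "\<pi> j < r" if "j < r" for j
    using permutes_in_image[OF assms(3)] that by auto
  then show ?thesis
    using assms(1)
    by (subst solves_weights_iff[where \<Gamma> = "\<lambda>j. \<Lambda> (\<pi> j)" and \<eta> = "\<lambda>j. \<xi> (\<pi> j)", OF _ _ _ assms(2) assms(4)])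
      (auto simp: moment_def mixture_permute[OF assms(3)])
qed

text \<open>The computed and the true weights, placed at the same points, give mixtures with equal moments.
Their difference is a mixture of operators of order at most \<open>l\<close> whose moments vanish.\<close>

lemma weights_unique:
  assumes "inj_on \<xi> {..<r}" and "\<And>j. j < r \<Longrightarrow> degree (\<Lambda> j) \<le> l"
    and "ms = map (moment (mixture r \<Lambda> \<xi>)) [0..<L]" and "(l + 1) * r \<le> L"
    and "\<pi> permutes {..<r}" and "\<And>j. j < r \<Longrightarrow> x $ j = \<xi> (\<pi> j)"
    and "solves_weights l r ms x w" and "j < r" and "k \<le> l"
  shows "w $$ (j, k) = coeff (\<Lambda> (\<pi> j)) k"
proof -
  define \<Gamma> where "\<Gamma> j = (\<Sum>k\<le>l. monom (w $$ (j, k)) k)" for j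
  have coeff_\<Gamma>: "coeff (\<Gamma> j) k = (if k \<le> l then w $$ (j, k) else 0)" for j k
    by (simp add: \<Gamma>_def coeff_sum)
  have deg_\<Gamma>: "degree (\<Gamma> j) \<le> l" for j
    by (rule degree_le) (simp add: coeff_\<Gamma>)
  have w: "w \<in> carrier_mat r (l + 1)"
    using assms(7) by (simp add: solves_weights_def)
  have \<pi>: "\<pi> j < r" if "j < r" for j
    using permutes_in_image[OF assms(5)] that by auto
  have "moment (mixture r \<Gamma> (\<lambda>j. \<xi> (\<pi> j))) i = moment (mixture r \<Lambda> \<xi>) i" if "i < L" for i
    using assms(7) that
    by (subst (asm) solves_weights_iff[where \<Gamma> = \<Gamma>, OF deg_\<Gamma> _ w assms(3) assms(6)])
      (simp_all add: coeff_\<Gamma>)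
  then have "moment (mixture r (\<lambda>j. \<Gamma> j - \<Lambda> (\<pi> j)) (\<lambda>j. \<xi> (\<pi> j))) i = 0" if "i < (l + 1) * r" for i
    using that assms(4) by (simp add: moment_def mixture_diff mixture_permute[OF assms(5)])
  moreover have "inj_on (\<lambda>j. \<xi> (\<pi> j)) {..<r}"
    using comp_inj_on[OF permutes_inj_on[OF assms(5), of "{..<r}"]] assms(1)
    by (simp add: comp_def permutes_image[OF assms(5)])
  ultimately have "\<Gamma> j - \<Lambda> (\<pi> j) = 0"
    using assms(2,8) deg_\<Gamma> \<pi>
    by (intro mixture_eq_0_imp_weights_eq_0[where \<xi> = "\<lambda>j. \<xi> (\<pi> j)" and \<Lambda> = "\<lambda>j. \<Gamma> j - \<Lambda> (\<pi> j)"])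
      (auto intro: degree_diff_le)
  then show ?thesis
    using coeff_\<Gamma>[of j k] assms(9) by simp
qed

section \<open>Runs of the algorithm\<close>

lemma mset_list_of_vec_eqE:
  assumes "x \<in> carrier_vec r" "mset (list_of_vec x) = mset (map \<xi> [0..<r])"
  obtains \<pi> where "\<pi> permutes {..<r}" "\<And>j. j < r \<Longrightarrow> x $ j = \<xi> (\<pi> j)"
proof -
  obtain \<pi> where \<pi>: "\<pi> permutes {..<r}" "permute_list \<pi> (map \<xi> [0..<r]) = list_of_vec x"
    using mset_eq_permutation[OF assms(2)] by auto
  have "x $ j = \<xi> (\<pi> j)" if "j < r" for j
  proof -
    have "x $ j = list_of_vec x ! j"
      using that assms(1) by (simp add: list_of_vec_index)
    also have "\<dots> = map \<xi> [0..<r] ! \<pi> j"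
      using \<pi> that by (simp add: permute_list_nth flip: \<pi>(2))
    also have "\<dots> = \<xi> (\<pi> j)"
      using permutes_in_image[OF \<pi>(1), of j] that by simp
    finally show ?thesis .
  qed
  with \<pi>(1) show thesis by (rule that)
qed

text \<open>A bound for the number of steps left. The phases after \<open>Solve\<close> count down from 2; in the phase
\<open>Solve\<close>, \<open>b\<close> stands for a strict upper bound on the row indices reached by adding rows, and the
offset 3 keeps this phase above the later ones even when \<open>a \<ge> b\<close>.\<close>

fun remaining_work :: "nat \<Rightarrow> 'a::zero recovery_state \<Rightarrow> nat" where
  "remaining_work b (Solve a) = 3 + (b - a)"
| "remaining_work b (Found p) = 2"
| "remaining_work b (Roots x) = 1"
| "remaining_work b (Output x w) = 0"

lemma terminates_always: "terminates l r ms"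
proof -
  let ?f = "remaining_work (length ms)"
  have decr: "?f s' < ?f s" if "recovery_step l r ms s s'" for s s'
    using that by cases auto
  show ?thesis
    unfolding terminates_def
  proof (rule notI, elim exE conjE)
    fix s :: "nat \<Rightarrow> 'a recovery_state"
    assume run: "\<forall>n. recovery_step l r ms (s n) (s (Suc n))"
    have "?f (s n) + n \<le> ?f (s 0)" for n
    proof (induction n)
      case (Suc n)
      then show ?case using decr[of "s n" "s (Suc n)"] run by force
    qed simp
    from this[of "Suc (?f (s 0))"] show False by simp
  qed
qed

fun run_invariant ::
  "nat \<Rightarrow> nat \<Rightarrow> 'a::field_char_0 list \<Rightarrow> (nat \<Rightarrow> 'a) \<Rightarrow> 'a recovery_state \<Rightarrow> bool" where
  "run_invariant l r ms \<xi> (Solve a) \<longleftrightarrow> a + (l + 1) * r < length ms"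
| "run_invariant l r ms \<xi> (Found p) \<longleftrightarrow> p = node_poly r \<xi>"
| "run_invariant l r ms \<xi> (Roots x) \<longleftrightarrow>
     x \<in> carrier_vec r \<and> mset (list_of_vec x) = mset (map \<xi> [0..<r])"
| "run_invariant l r ms \<xi> (Output x w) \<longleftrightarrow>
     x \<in> carrier_vec r \<and> mset (list_of_vec x) = mset (map \<xi> [0..<r]) \<and> solves_weights l r ms x w"

text \<open>A unique solution must be the polynomial of the true points, because that polynomial is always a
solution; this is the only step at which the invariant could fail.\<close>

lemma reachable_run_invariant:
  assumes "\<And>a. a + (l + 1) * r < length ms \<Longrightarrow> node_poly r \<xi> \<in> solutions l r ms a"
    and "r - 1 + (l + 1) * r < length ms" and "reachable l r ms s"
  shows "run_invariant l r ms \<xi> s"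
  using assms(3) unfolding reachable_def
proof (induction rule: rtranclp_induct)
  case base
  then show ?case using assms(2) by simp
next
  case (step s s')
  from step.hyps(2) show ?case
  proof cases
    case (unique a p)
    then show ?thesis using assms(1)[of a] step.IH by simp
  qed (use step.IH in \<open>auto simp: proots_node_poly\<close>)
qed

theorem proposition5p2:
  fixes l r :: nat
    and \<xi> :: "nat \<Rightarrow> 'a::field_char_0"
    and \<Lambda> :: "nat \<Rightarrow> 'a poly"
    and \<mu> :: "'a poly \<Rightarrow> 'a"
    and ms :: "'a list"
  assumes "r \<ge> 1"
    and "inj_on \<xi> {..<r}"
    and "\<And>j. j < r \<Longrightarrow> \<Lambda> j \<noteq> 0 \<and> degree (\<Lambda> j) = l"
    and "\<mu> = mixture r \<Lambda> \<xi>"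
    and "ms = map (moment \<mu>) [0..<2 * (l + 1) * r]"
  shows "terminates l r ms \<and> never_stuck l r ms \<and>
    (\<forall>x w. reachable l r ms (Output x w) \<longrightarrow>
       x \<in> carrier_vec r \<and> w \<in> carrier_mat r (l + 1) \<and>
       (\<exists>\<pi>. \<pi> permutes {..<r} \<and>
          (\<forall>j<r. x $ j = \<xi> (\<pi> j) \<and> (\<forall>k\<le>l. w $$ (j, k) = coeff (\<Lambda> (\<pi> j)) k))))"
proof -
  let ?N = "(l + 1) * r"
  have len: "length ms = 2 * ?N"
    using assms(5) by simp
  have ms: "ms = map (moment (mixture r \<Lambda> \<xi>)) [0..<2 * ?N]"
    by (simp only: assms(4,5) mult.assoc)
  have deg: "degree (\<Lambda> j) \<le> l" if "j < r" for j
    using assms(3)[OF that] by simp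
  have "r \<le> ?N" by simp
  have true_solution: "node_poly r \<xi> \<in> solutions l r ms a" if "a + ?N < length ms" for a
    using node_poly_mem_solutions[OF deg _ ms] that len by simp
  \<comment> \<open>The last row index for which all entries of the system are known moments.\<close>
  have full: "solutions l r ms (?N - 1) = {node_poly r \<xi>}"
    using assms(1) \<open>r \<le> ?N\<close>
    by (intro solutions_full_eq[OF assms(2,3) _ ms]) auto
  have inv: "run_invariant l r ms \<xi> s" if "reachable l r ms s" for s
    by (rule reachable_run_invariant[OF true_solution _ that])
      (use \<open>r \<le> ?N\<close> assms(1) len in auto)
  have progress: "(\<exists>x w. s = Output x w) \<or> (\<exists>s'. recovery_step l r ms s s')"
    if "reachable l r ms s" for s
  proof (cases s)
    case (Solve a)
    then have a: "a + ?N < length ms" using inv[OF that] by simp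
    show ?thesis
    proof (cases "solutions l r ms a = {node_poly r \<xi>}")
      case True
      then show ?thesis using Solve recovery_step.unique by blast
    next
      case False
      \<comment> \<open>Non-uniqueness means that the last admissible row index is not yet reached, so it is a legal next step.\<close>
      then have "a \<noteq> ?N - 1" using full by auto
      then have more: "a < ?N - 1" "?N - 1 + ?N < length ms"
        using a len by auto
      show ?thesis
      proof (cases "finite (solutions l r ms a)")
        case True
        have "card {node_poly r \<xi>} < card (solutions l r ms a)"
          using False true_solution[OF a] by (intro psubset_card_mono[OF True]) auto
        then show ?thesis
          using recovery_step.finitely_many[OF True _ more] Solve by auto
      next
        case infinite: False
        then show ?thesis
          using recovery_step.infinitely_many[OF infinite more] Solve by auto
      qed
    qed
  next
    case (Found p)
    have "recovery_step l r ms (Found p) (Roots (vec r \<xi>))"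
    proof (rule recovery_step.roots)
      have "list_of_vec (vec r \<xi>) = map \<xi> [0..<r]"
        by (rule nth_equalityI) (simp_all add: list_of_vec_index)
      then show "mset (list_of_vec (vec r \<xi>)) = proots p"
        using inv[OF that] Found by (simp add: proots_node_poly)
    qed simp
    then show ?thesis using Found by blast
  next
    case (Roots x)
    then have x: "x \<in> carrier_vec r" "mset (list_of_vec x) = mset (map \<xi> [0..<r])"
      using inv[OF that] by simp_all
    obtain \<pi> where "\<pi> permutes {..<r}" "\<And>j. j < r \<Longrightarrow> x $ j = \<xi> (\<pi> j)"
      using mset_list_of_vec_eqE[OF x] by blast
    then show ?thesis
      using true_weights_solve[OF deg ms] recovery_step.weights Roots by blast
  qed blast
  have "x \<in> carrier_vec r \<and> w \<in> carrier_mat r (l + 1) \<and>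
       (\<exists>\<pi>. \<pi> permutes {..<r} \<and>
          (\<forall>j<r. x $ j = \<xi> (\<pi> j) \<and> (\<forall>k\<le>l. w $$ (j, k) = coeff (\<Lambda> (\<pi> j)) k)))"
    if "reachable l r ms (Output x w)" for x w
  proof -
    have x: "x \<in> carrier_vec r" "mset (list_of_vec x) = mset (map \<xi> [0..<r])"
      and w: "solves_weights l r ms x w"
      using inv[OF that] by simp_all
    obtain \<pi> where \<pi>: "\<pi> permutes {..<r}" "\<And>j. j < r \<Longrightarrow> x $ j = \<xi> (\<pi> j)"
      using mset_list_of_vec_eqE[OF x] by blast
    have "w $$ (j, k) = coeff (\<Lambda> (\<pi> j)) k" if "j < r" "k \<le> l" for j k
      by (rule weights_unique[OF assms(2) deg ms _ \<pi> w that]) simp_all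
    then show ?thesis
      using x(1) w \<pi> by (auto simp: solves_weights_def)
  qed
  then show ?thesis
    using terminates_always progress by (auto simp: never_stuck_def)
qed

end
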